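(* Fix $m \in \mathbb{N}$. For any $n \in \mathbb{N}$ such that $m < n$ and $n \equiv m \pmod{m+1}$, it follows that $\operatorname{spec}(A_m) \subset \operatorname{spec}(A_n)$.
   Context: For $n \in \mathbb{N} = \{1,2,3,\ldots\}$, $A_n$ denotes the $n \times n$ real symmetric tridiagonal matrix whose diagonal entries are all $0$, whose superdiagonal and subdiagonal entries are all $1$, and whose other entries are all $0$ (so $A_1 = [0]$). For a square complex matrix $A$, $\operatorname{spec}(A)$ denotes the multiset of eigenvalues of $A$. *)

theory Defs
  imports
    "HOL-Number_Theory.Cong"
    "HOL-Computational_Algebra.Polynomial"
    "Jordan_Normal_Form.Char_Poly"
begin

definition A_mat :: "nat \<Rightarrow> real mat" where
  "A_mat n = mat n n (\<lambda>(i, j). if j = Suc i \<or> i = Suc j then 1 else 0)"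

(* Eigenvalues are counted with algebraic multiplicity, i.e. as roots of the
   characteristic polynomial.  For non-square input the value is meaningless. *)
definition spec :: "complex mat \<Rightarrow> complex multiset" where
  "spec A = proots (char_poly A)"

end

(* Expanding det (x I - A_n) along the first column gives p_{n+2} = x p_{n+1} - p_n for the
   characteristic polynomials, hence p_{a+b+2} = p_{a+1} p_{b+1} - p_a p_b.  With a + 1 = m this
   shows that if p_m divides p_b, then p_m divides p_{b+m+1}; so p_m divides p_n whenever
   n = m + k (m + 1).  The inclusion is strict since the degrees differ. *)
theory Submission
  imports Defs "HOL-Computational_Algebra.Fundamental_Theorem_Algebra"
begin

text \<open>\<open>A_mat n\<close> is the adjacency matrix of the path on n vertices, whence the
  name. These polynomials are the Chebyshev polynomials of the second kind, U_n(x/2).\<close>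

abbreviation path_poly :: "nat \<Rightarrow> complex poly" where
  "path_poly n \<equiv> char_poly (map_mat complex_of_real (A_mat n))"

lemma degree_path_poly: "degree (path_poly n) = n"
  and path_poly_nonzero: "path_poly n \<noteq> 0"
proof -
  have "map_mat complex_of_real (A_mat n) \<in> carrier_mat n n"
    by (simp add: A_mat_def)
  from degree_monic_char_poly[OF this]
  show "degree (path_poly n) = n" "path_poly n \<noteq> 0" by auto
qed

lemma char_poly_matrix_A_mat:
  "char_poly_matrix (map_mat complex_of_real (A_mat n)) =
    mat n n (\<lambda>(i, j). if i = j then [:0, 1:] else if j = Suc i \<or> i = Suc j then -1 else 0)"
  by (rule eq_matI) (auto simp: char_poly_matrix_def A_mat_def one_pCons)

lemma path_poly_0: "path_poly 0 = 1"
  by (simp add: char_poly_def char_poly_matrix_A_mat)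

lemma path_poly_1: "path_poly (Suc 0) = [:0, 1:]"
  by (simp add: char_poly_def char_poly_matrix_A_mat det_single)

lemma path_poly_Suc_Suc:
  "path_poly (Suc (Suc n)) = [:0, 1:] * path_poly (Suc n) - path_poly n"
proof -
  define C where "C k = char_poly_matrix (map_mat complex_of_real (A_mat k))" for k
  note C_mat = C_def[unfolded char_poly_matrix_A_mat]
  \<comment> \<open>The first column of \<open>C (Suc (Suc n))\<close> is (x, -1, 0, ...), so only
    two minors matter. \<open>B\<close> is the one belonging to the entry -1; its first row is (-1,
    0, ..., 0), so a second expansion reduces it to \<open>C n\<close>.\<close>
  define B where "B = mat_delete (C (Suc (Suc n))) (Suc 0) 0"
  have C_carrier: "C k \<in> carrier_mat k k" for k
    by (simp add: C_mat)
  have B_carrier: "B \<in> carrier_mat (Suc n) (Suc n)"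
    unfolding B_def mat_delete_def by (simp add: C_mat)
  have del_C: "mat_delete (C (Suc (Suc n))) 0 0 = C (Suc n)"
    by (rule eq_matI) (auto simp: mat_delete_def C_mat)
  have del_B: "mat_delete B 0 0 = C n"
    by (rule eq_matI) (auto simp: mat_delete_def C_mat B_def)
  have "det B = (\<Sum>j<Suc n. B $$ (0, j) * cofactor B 0 j)"
    by (rule laplace_expansion_row[OF B_carrier]) simp
  also have "\<dots> = B $$ (0, 0) * cofactor B 0 0 + (\<Sum>j<n. B $$ (0, Suc j) * cofactor B 0 (Suc j))"
    by (rule sum.lessThan_Suc_shift)
  also have "(\<Sum>j<n. B $$ (0, Suc j) * cofactor B 0 (Suc j)) = 0"
    by (rule sum.neutral) (auto simp: B_def mat_delete_def C_mat)
  also have "B $$ (0, 0) = -1"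
    by (simp add: B_def mat_delete_def C_mat)
  finally have det_B: "det B = - det (C n)"
    by (simp add: cofactor_def del_B)
  let ?t = "\<lambda>i. C (Suc (Suc n)) $$ (i, 0) * cofactor (C (Suc (Suc n))) i 0"
  have "det (C (Suc (Suc n))) = (\<Sum>i<Suc (Suc n). ?t i)"
    by (rule laplace_expansion_column[OF C_carrier]) simp
  also have "\<dots> = ?t 0 + (?t (Suc 0) + (\<Sum>i<n. ?t (Suc (Suc i))))"
    unfolding sum.lessThan_Suc_shift ..
  also have "(\<Sum>i<n. ?t (Suc (Suc i))) = 0"
    by (rule sum.neutral) (auto simp: C_mat)
  also have "?t 0 = [:0, 1:] * det (C (Suc n))"
    by (simp add: cofactor_def del_C) (simp add: C_mat)
  \<comment> \<open>The entry -1 cancels against the cofactor sign at position (1, 0).\<close>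
  also have "?t (Suc 0) = det B"
    by (simp add: cofactor_def flip: B_def) (simp add: C_mat)
  finally show ?thesis
    by (simp add: det_B char_poly_def flip: C_def)
qed

text \<open>The recurrence, applied once to each factor, shows that the right-hand side is unchanged
  when one unit moves from \<open>a\<close> to \<open>b\<close>; hence \<open>b\<close> stays
  arbitrary in the induction.\<close>

lemma path_poly_add:
  "path_poly (Suc a + Suc b) = path_poly (Suc a) * path_poly (Suc b) - path_poly a * path_poly b"
proof (induction a arbitrary: b)
  case 0
  then show ?case by (simp add: path_poly_Suc_Suc path_poly_0 path_poly_1)
next
  case (Suc a)
  \<comment> \<open>Naming the variable keeps the simplifier from rewriting products with
    \<open>[:0, 1:]\<close>, so that only ring identities remain.\<close>
  define X where "X = [:0, 1 :: complex:]"
  note rec = path_poly_Suc_Suc[folded X_def]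
  have "path_poly (Suc (Suc a) + Suc b) = path_poly (Suc a + Suc (Suc b))"
    by simp
  then show ?case
    unfolding Suc.IH by (simp add: rec algebra_simps)
qed

lemma path_poly_dvd:
  assumes "m \<ge> 1"
  shows "path_poly m dvd path_poly (m + k * (m + 1))"
proof (induction k)
  case (Suc k)
  obtain a where m: "m = Suc a"
    using assms by (cases m) auto
  \<comment> \<open>Splitting off m + 1 makes \<open>path_poly m\<close> a factor of the first
    product in \<open>path_poly_add\<close>; the induction hypothesis covers the second.\<close>
  have "path_poly (m + Suc k * (m + 1)) = path_poly (Suc a + Suc (m + k * (m + 1)))"
    by (simp add: m algebra_simps)
  then show ?case
    using Suc unfolding path_poly_add by (simp add: m)
qed simp

text \<open>Root multisets add up under products of nonzero polynomials, and q \<noteq> 0 makes both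
  factors nonzero.\<close>

lemma proots_subset_if_dvd:
  fixes p q :: "'a :: idom poly"
  assumes "p dvd q" "q \<noteq> 0"
  shows "proots p \<subseteq># proots q"
proof -
  obtain r where "q = p * r"
    using assms(1) by (elim dvdE)
  with assms(2) show ?thesis
    by (simp add: proots_mult)
qed

theorem theorem4p5:
  fixes m n :: nat
  assumes "m \<ge> 1" and "n \<ge> 1"
    and "m < n"
    and "[n = m] (mod (m + 1))"
  shows "spec (map_mat complex_of_real (A_mat m)) \<subset># spec (map_mat complex_of_real (A_mat n))"
proof -
  obtain k where "n = m + k * (m + 1)"
    using assms(3,4) by (metis cong_sym cong_le_nat less_imp_le add.commute mult.commute)
  then have "path_poly m dvd path_poly n"
    using path_poly_dvd[OF assms(1)] by simp
  then have "proots (path_poly m) \<subseteq># proots (path_poly n)"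
    by (rule proots_subset_if_dvd) (rule path_poly_nonzero)
  \<comment> \<open>By the fundamental theorem of algebra, the number of complex roots with
    multiplicity is the degree, here m and n.\<close>
  moreover have "size (proots (path_poly m)) < size (proots (path_poly n))"
    using assms(3) by (simp add: size_proots_complex degree_path_poly)
  ultimately show ?thesis
    by (auto simp: spec_def subset_mset_def)
qed

end
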